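(* Let $m,n$ be integers with $n>3$, $m\ge 3$ and $n\ge m$. Let $\mathcal H_m$ and $\mathcal H_n$ be complex Hilbert spaces of dimensions $m$ and $n$, with orthonormal bases $|0\rangle,\ldots,|m-1\rangle$ and $|0\rangle,\ldots,|n-1\rangle$ respectively, and let $\omega=e^{2\pi i/(n-2)}$. Let $\mathbf{GenTiles2}$ be the set consisting of the following vectors of $\mathcal H_m\otimes\mathcal H_n$: $$|S_j\rangle=\frac{1}{\sqrt2}\bigl(|j\rangle-|\,(j+1) \bmod m\,\rangle\bigr)\otimes|j\rangle,\qquad 0\le j\le m-1,$$ $$|L_{jk}\rangle=|j\rangle\otimes\frac{1}{\sqrt{n-2}}\left(\sum_{i=0}^{m-3}\omega^{ik}\,|\,(i+j+1) \bmod m\,\rangle+\sum_{i=m-2}^{n-3}\omega^{ik}\,|i+2\rangle\right),\qquad 0\le j\le m-1,\ 1\le k\le n-3,$$ $$|F\rangle=\frac{1}{\sqrt{nm}}\sum_{i=0}^{m-1}\sum_{j=0}^{n-1}|i\rangle\otimes|j\rangle .$$ (When $n=m$ the second sum in $|L_{jk}\rangle$ is empty.) Then $\mathbf{GenTiles2}$ is an unextendible product basis of $\mathcal H_m\otimes\mathcal H_n$.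
   Context: A product state in $\mathcal H_A\otimes\mathcal H_B$ (with $\mathcal H_A,\mathcal H_B$ finite-dimensional complex Hilbert spaces) is a nonzero vector of the form $|\alpha\rangle\otimes|\beta\rangle$ with $|\alpha\rangle\in\mathcal H_A$, $|\beta\rangle\in\mathcal H_B$. A partial product basis of $\mathcal H=\mathcal H_A\otimes\mathcal H_B$ is a set $S$ of mutually orthonormal product states spanning a proper subspace $\mathcal H_S$ of $\mathcal H$. An unextendible product basis (UPB) is a partial product basis $S$ whose complementary subspace $\mathcal H_S^{\perp}$ (the orthogonal complement of $\mathcal H_S$ in $\mathcal H$) contains no product state. *)

theory Defs
  imports "HOL-Analysis.Analysis"
begin

definition cinner :: "complex ^ 'a::finite \<Rightarrow> complex ^ 'a \<Rightarrow> complex" where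
  "cinner u v = (\<Sum>i\<in>UNIV. cnj (u $ i) * v $ i)"

text \<open>The tensor product of \<open>complex ^ 'a\<close> and \<open>complex ^ 'b\<close> is realised as
  \<open>complex ^ ('a \<times> 'b)\<close>; on product vectors \<open>cinner\<close> is multiplicative, so this is the
  usual Hilbert space structure on the tensor product.\<close>

definition tensor :: "complex ^ 'a::finite \<Rightarrow> complex ^ 'b::finite \<Rightarrow> complex ^ ('a \<times> 'b)"
    (infixr \<open>\<otimes>\<close> 75) where
  "u \<otimes> v = (\<chi> p. u $ fst p * v $ snd p)"

definition orthonormal :: "(complex ^ 'a::finite) set \<Rightarrow> bool" where
  "orthonormal S \<longleftrightarrow> (\<forall>x\<in>S. cinner x x = 1) \<and> (\<forall>x\<in>S. \<forall>y\<in>S. x \<noteq> y \<longrightarrow> cinner x y = 0)"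

text \<open>An orthonormal basis \<open>e 0, \<dots>, e (d - 1)\<close>; the values \<open>e i\<close> with \<open>i \<ge> d\<close> are irrelevant.\<close>

definition orthonormal_basis :: "nat \<Rightarrow> (nat \<Rightarrow> complex ^ 'a::finite) \<Rightarrow> bool" where
  "orthonormal_basis d e \<longleftrightarrow>
     inj_on e {..<d} \<and> orthonormal (e ` {..<d}) \<and> vec.span (e ` {..<d}) = UNIV"

definition orthogonal_complement :: "(complex ^ 'a::finite) set \<Rightarrow> (complex ^ 'a) set" where
  "orthogonal_complement V = {x. \<forall>y\<in>V. cinner y x = 0}"

definition product_state :: "complex ^ ('a::finite \<times> 'b::finite) \<Rightarrow> bool" where
  "product_state x \<longleftrightarrow> x \<noteq> 0 \<and> (\<exists>a b. x = a \<otimes> b)"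

definition partial_product_basis :: "(complex ^ ('a::finite \<times> 'b::finite)) set \<Rightarrow> bool" where
  "partial_product_basis S \<longleftrightarrow>
     (\<forall>x\<in>S. product_state x) \<and> orthonormal S \<and> vec.span S \<subset> UNIV"

definition unextendible_product_basis :: "(complex ^ ('a::finite \<times> 'b::finite)) set \<Rightarrow> bool" where
  "unextendible_product_basis S \<longleftrightarrow>
     partial_product_basis S \<and> \<not> (\<exists>x\<in>orthogonal_complement (vec.span S). product_state x)"

definition stile :: "nat \<Rightarrow> (nat \<Rightarrow> complex ^ 'a::finite) \<Rightarrow> (nat \<Rightarrow> complex ^ 'b::finite) \<Rightarrow> nat
    \<Rightarrow> complex ^ ('a \<times> 'b)" where
  "stile m e f j = (complex_of_real (1 / sqrt 2) *s (e j - e ((j + 1) mod m))) \<otimes> f j"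

text \<open>The natural-number subtractions below are only used for \<open>m \<ge> 3\<close> and \<open>n > 3\<close>, where they
  do not truncate; for \<open>n = m\<close> the range \<open>{m - 2..n - 3}\<close> is empty.\<close>

definition ltile :: "nat \<Rightarrow> nat \<Rightarrow> (nat \<Rightarrow> complex ^ 'a::finite) \<Rightarrow> (nat \<Rightarrow> complex ^ 'b::finite) \<Rightarrow> nat \<Rightarrow> nat
    \<Rightarrow> complex ^ ('a \<times> 'b)" where
  "ltile m n e f j k =
     (let \<omega> = exp (2 * complex_of_real pi * \<i> / of_nat (n - 2)) in
      e j \<otimes> (complex_of_real (1 / sqrt (real (n - 2))) *s
        ((\<Sum>i = 0..m - 3. \<omega> ^ (i * k) *s f ((i + j + 1) mod m)) +
         (\<Sum>i = m - 2..n - 3. \<omega> ^ (i * k) *s f (i + 2)))))"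

definition ftile :: "nat \<Rightarrow> nat \<Rightarrow> (nat \<Rightarrow> complex ^ 'a::finite) \<Rightarrow> (nat \<Rightarrow> complex ^ 'b::finite)
    \<Rightarrow> complex ^ ('a \<times> 'b)" where
  "ftile m n e f =
     complex_of_real (1 / sqrt (real (n * m))) *s (\<Sum>i = 0..m - 1. \<Sum>j = 0..n - 1. e i \<otimes> f j)"

definition GenTiles2 :: "nat \<Rightarrow> nat \<Rightarrow> (nat \<Rightarrow> complex ^ 'a::finite) \<Rightarrow> (nat \<Rightarrow> complex ^ 'b::finite)
    \<Rightarrow> (complex ^ ('a \<times> 'b)) set" where
  "GenTiles2 m n e f =
     {stile m e f j | j. j \<le> m - 1} \<union>
     {ltile m n e f j k | j k. j \<le> m - 1 \<and> 1 \<le> k \<and> k \<le> n - 3} \<union>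
     {ftile m n e f}"

end

theory Submission
  imports Defs
begin

text \<open>
  Index the cells of an \<open>m\<close> by \<open>n\<close> grid by the product basis vectors. The short tile \<open>S\<^sub>j\<close>
  occupies rows \<open>j, j + 1\<close> of column \<open>j\<close>; the vectors \<open>L\<^sub>j\<^sub>k\<close> are the nontrivial characters on the
  remaining \<open>n - 2\<close> cells of row \<open>j\<close>. So the tiles are disjoint, and orthonormality follows from
  the orthogonality of characters. For unextendibility, let \<open>\<alpha>\<close>, \<open>\<beta>\<close> be the coordinates of a
  product state orthogonal to everything. Then \<open>\<alpha>\<^sub>i \<beta>\<^sub>c\<close> is constant on each tile: hence
  \<open>\<beta>\<^sub>j = 0\<close> or \<open>\<alpha>\<^sub>j = \<alpha>\<^sub>j\<^sub>+\<^sub>1\<close>, and whenever \<open>\<alpha>\<^sub>j \<noteq> 0\<close>, \<open>\<beta>\<close> is constant off the columns \<open>j - 1, j\<close>.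
  Going around the cycle, this forces both \<open>\<Sum>\<alpha>\<close> and \<open>\<Sum>\<beta>\<close> to be nonzero, contradicting
  orthogonality to \<open>F\<close>.
\<close>

section \<open>Constancy on tiles\<close>

lemma cyclic_induct:
  fixes m :: nat
  assumes "j0 < m" "Q j0" and step: "\<And>j. j < m \<Longrightarrow> Q j \<Longrightarrow> Q ((j + 1) mod m)" and "i < m"
  shows "Q i"
proof -
  have "Q ((j0 + k) mod m)" for k
  proof (induction k)
    case 0
    then show ?case using assms by simp
  next
    case (Suc k)
    then show ?case using step[of "(j0 + k) mod m"] \<open>j0 < m\<close> by (simp add: mod_Suc_eq)
  qed
  \<comment> \<open>Passing through \<open>m\<close> on the way to \<open>i\<close> avoids the
    truncated subtraction \<open>i - j0\<close>.\<close>
  from this[of "m - j0 + i"] show ?thesis using \<open>j0 < m\<close> \<open>i < m\<close> by simp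
qed

lemma exists_fourth:
  fixes n :: nat
  assumes "n > 3"
  shows "\<exists>d<n. d \<noteq> x \<and> d \<noteq> y \<and> d \<noteq> z"
proof -
  have "card {x, y, z} \<le> 3" by (simp add: card_insert_if)
  then have "\<not> {..<n} \<subseteq> {x, y, z}"
    using card_mono[of "{x, y, z}" "{..<n}"] assms by fastforce
  then show ?thesis by auto
qed

text \<open>Only three patterns survive: \<open>a\<close> and \<open>b\<close> both constant;
  \<open>a\<close> with one value on two adjacent rows and \<open>b\<close> on a single column;
  \<open>a\<close> on a single row and \<open>b\<close> constant off two columns, where it vanishes.
  In each, both sums are positive integer multiples of a nonzero value, hence nonzero in
  characteristic zero.\<close>

lemma tile_constant_sums_nonzero:
  fixes a b :: "nat \<Rightarrow> 'k::{idom, ring_char_0}"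
  assumes m: "m \<ge> 3" and nm: "n \<ge> m" and n: "n > 3"
    and col: "\<And>j. j < m \<Longrightarrow> b j = 0 \<or> a j = a ((j + 1) mod m)"
    and row: "\<And>j c c'. j < m \<Longrightarrow> a ((j + 1) mod m) \<noteq> 0 \<Longrightarrow> c \<in> {..<n} - {j, (j + 1) mod m} \<Longrightarrow>
                c' \<in> {..<n} - {j, (j + 1) mod m} \<Longrightarrow> b c = b c'"
    and a: "\<exists>i<m. a i \<noteq> 0" and b: "\<exists>j<n. b j \<noteq> 0"
  shows "sum a {..<m} * sum b {..<n} \<noteq> 0"
proof -
  define s where "s j = (j + 1) mod m" for j
  have s_lt: "s j < m" for j using m by (simp add: s_def)
  have s_val: "s j = (if j = m - 1 then 0 else j + 1)" if "j < m" for j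
    using that m by (auto simp: s_def)
  \<comment> \<open>The second inequality holds because the cycle has length at least three.\<close>
  have s_neq: "s j \<noteq> j" "s (s j) \<noteq> j" if "j < m" for j
    using that m s_val[OF that] s_val[OF s_lt, of j] by (auto split: if_splits)
  have s_surj: "\<exists>l<m. s l = j" if "j < m" for j
    using that m s_val[of "if j = 0 then m - 1 else j - 1"]
    by (intro exI[of _ "if j = 0 then m - 1 else j - 1"]) auto
  note col = col[folded s_def] and row = row[folded s_def]
  have ind: "Q i" if "j0 < m" "Q j0" "\<And>j. j < m \<Longrightarrow> Q j \<Longrightarrow> Q (s j)" "i < m" for Q i j0
    using cyclic_induct[of j0 m Q i] that by (simp add: s_def)
  obtain i0 where i0: "i0 < m" "a i0 \<noteq> 0" using a by blast
  obtain c0 where c0: "c0 < n" "b c0 \<noteq> 0" using b by blast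
  show ?thesis
  proof (cases "\<forall>i<m. a i \<noteq> 0")
    case True
    have row': "b c = b c'" if "j < m" "c < n" "c' < n" "c \<notin> {j, s j}" "c' \<notin> {j, s j}" for j c c'
      using row[of j c c'] True s_lt that by auto
    define p where "p = (0::nat)"
    have p: "p < m" using m by (simp add: p_def)
    \<comment> \<open>Each of \<open>d\<close> and \<open>d'\<close> avoids two consecutive omitted
      pairs. The row omitting \<open>{s p, s (s p)}\<close> compares them with each other and with
      most columns; its two omitted columns are compared in the neighbouring rows.\<close>
    obtain d where d: "d < n" "d \<noteq> p" "d \<noteq> s p" "d \<noteq> s (s p)"
      using exists_fourth[OF n, of p "s p" "s (s p)"] by blast
    obtain d' where d': "d' < n" "d' \<noteq> s p" "d' \<noteq> s (s p)" "d' \<noteq> s (s (s p))"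
      using exists_fourth[OF n, of "s p" "s (s p)" "s (s (s p))"] by blast
    have dd': "b d' = b d" using row'[of "s p" d' d] d d' s_lt by auto
    have const: "b c = b d" if c: "c < n" for c
    proof -
      consider "c \<notin> {s p, s (s p)}" | "c = s p" | "c = s (s p)" by blast
      then show ?thesis
      proof cases
        case 1
        then show ?thesis using row'[of "s p" c d] d c s_lt by auto
      next
        case 2
        then show ?thesis
          using row'[of "s (s p)" c d'] d' c s_lt dd' s_neq[of "s p"] by auto
      next
        case 3
        then show ?thesis
          using row'[of p c d] d c p s_lt s_neq[of p] s_neq[of "s p"] by auto
      qed
    qed
    have bd: "b d \<noteq> 0" using const c0 by metis
    \<comment> \<open>\<open>b\<close> vanishes on no column, so \<open>col\<close> carries the
      value of \<open>a\<close> around the cycle.\<close>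
    have "a i = a i0" if "i < m" for i
      using ind[of i0 "\<lambda>i. a i = a i0" i] i0 that col const bd nm
      by (metis le_trans linorder_not_le)
    then have "sum a {..<m} = of_nat m * a i0" by simp
    moreover have "sum b {..<n} = of_nat n * b d" using const by simp
    ultimately show ?thesis using i0 bd m n by simp
  next
    case False
    then obtain i1 where i1: "i1 < m" "a i1 = 0" by blast
    \<comment> \<open>Without such a step up, the zero at \<open>i1\<close> would spread around the
      cycle to \<open>i0\<close>; dually for the step down at \<open>q\<close>.\<close>
    obtain p where p: "p < m" "a p = 0" "a (s p) \<noteq> 0"
      using ind[of i1 "\<lambda>i. a i = 0" i0] i0 i1 by blast
    obtain q where q: "q < m" "a q \<noteq> 0" "a (s q) = 0"
      using ind[of i0 "\<lambda>i. a i \<noteq> 0" i1] i0 i1 by blast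
    have bp: "b p = 0" and bq: "b q = 0" using col p q by metis+
    have const: "b c = b c'" if "c < n" "c' < n" "c \<notin> {p, s p}" "c' \<notin> {p, s p}" for c c'
      using row[of p c c'] p that by auto
    show ?thesis
    proof (cases "q = s p")
      case False
      define r where "r = s p"
      have r: "r < m" "a r \<noteq> 0" using p s_lt by (auto simp: r_def)
      \<comment> \<open>Column \<open>q\<close> lies outside \<open>{p, s p}\<close> and has
        \<open>b q = 0\<close>, so the common value of \<open>b\<close> outside that pair is
        0.\<close>
      have off: "b c = 0" if "c < n" "c \<noteq> r" for c
        using const[of c q] that bp bq q p False nm by (cases "c = p") (auto simp: r_def)
      have br: "b r \<noteq> 0" using c0 off by metis
      have ar: "a (s r) = a r" using col[of r] r br by auto
      have supp: "i = r \<or> i = s r" if i: "i < m" "a i \<noteq> 0" for i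
      proof -
        obtain l where l: "l < m" "s l = i" using s_surj i by blast
        obtain d where d: "d < n" "d \<noteq> l" "d \<noteq> s l" "d \<noteq> r"
          using exists_fourth[OF n, of l "s l" r] by blast
        \<comment> \<open>If the nonzero row \<open>i\<close> did not omit column \<open>r\<close>,
          constancy would equate \<open>b r\<close> with \<open>b d = 0\<close>.\<close>
        have "r \<in> {l, s l}"
        proof (rule ccontr)
          assume "r \<notin> {l, s l}"
          then have "b r = b d" using row[of l r d] l d i r nm by auto
          then show False using off d br by auto
        qed
        then show ?thesis using l by auto
      qed
      have "sum a {..<m} = sum a {r, s r}"
        by (rule sum.mono_neutral_right) (use supp r s_lt in auto)
      also have "\<dots> = 2 * a r" using s_neq[of r] r ar by simp
      finally have "sum a {..<m} \<noteq> 0" using r by simp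
      moreover have "sum b {..<n} = sum b {r}"
        by (rule sum.mono_neutral_right) (use off r nm in auto)
      ultimately show ?thesis using br by simp
    next
      case True
      have c0': "c0 \<notin> {p, s p}" using c0 bp bq True by auto
      have bc: "b c = b c0" if "c < n" "c \<notin> {p, s p}" for c
        using const that c0 c0' by blast
      \<comment> \<open>Outside \<open>{p, s p}\<close> column \<open>j\<close> has
        \<open>b j\<close> nonzero, so \<open>col\<close> passes a zero of \<open>a\<close> from
        \<open>j\<close> to \<open>s j\<close>. From \<open>p\<close> the walk reaches the
        exceptional row \<open>s p\<close>, and after \<open>s p = q\<close> the choice of
        \<open>q\<close> gives a zero again.\<close>
      have supp: "i = s p \<or> a i = 0" if "i < m" for i
      proof (rule ind[of p "\<lambda>i. i = s p \<or> a i = 0"])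
        fix j assume j: "j < m" "j = s p \<or> a j = 0"
        show "s j = s p \<or> a (s j) = 0"
          using j q True col[of j] bc[of j] c0 nm by (cases "j = p"; cases "j = s p") auto
      qed (use p that in auto)
      have "sum a {..<m} = sum a {s p}"
        by (rule sum.mono_neutral_right) (use supp s_lt in auto)
      then have sa: "sum a {..<m} \<noteq> 0" using p by simp
      have "sum b {..<n} = sum b ({..<n} - {p, s p})"
        by (rule sum.mono_neutral_right) (use bp bq True in auto)
      also have "\<dots> = of_nat (card ({..<n} - {p, s p})) * b c0"
        using bc by simp
      also have "card ({..<n} - {p, s p}) = n - 2"
        using p s_lt[of p] s_neq[of p] nm by (subst card_Diff_subset) auto
      finally have "sum b {..<n} = of_nat (n - 2) * b c0" .
      moreover have "(of_nat (n - 2) :: 'k) \<noteq> 0"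
        using n by (simp only: of_nat_eq_0_iff)
      ultimately show ?thesis using sa c0 by (metis mult_eq_0_iff)
    qed
  qed
qed

section \<open>Characters of the cyclic group\<close>

text \<open>With \<open>N = n - 2\<close> this is the \<open>\<omega>\<close> inside
  \<open>ltile\<close>.\<close>

definition root_of_unity :: "nat \<Rightarrow> complex" where
  "root_of_unity N = exp (2 * complex_of_real pi * \<i> / of_nat N)"

lemma root_of_unity_power:
  "root_of_unity N ^ k = exp (2 * of_nat k * complex_of_real pi * \<i> / of_nat N)"
  by (simp add: root_of_unity_def flip: exp_of_nat_mult) (simp add: mult_ac)

lemma cnj_root_of_unity: "cnj (root_of_unity N) = inverse (root_of_unity N)"
  by (simp add: root_of_unity_def exp_cnj flip: exp_minus)

text \<open>A geometric sum whose ratio is an \<open>N\<close>-th root of unity, and different from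
  1 unless \<open>d = 0\<close> because \<open>N\<close> divides no nonzero \<open>d\<close> this
  small. The exponent is signed since it will be a difference of character indices.\<close>

lemma sum_root_of_unity:
  fixes d :: int
  assumes "N > 0" "\<bar>d\<bar> < int N"
  shows "(\<Sum>i<N. (root_of_unity N powi d) ^ i) = (if d = 0 then of_nat N else 0)"
proof (cases "d = 0")
  case False
  let ?z = "root_of_unity N powi d"
  have w0: "root_of_unity N \<noteq> 0" by (simp add: root_of_unity_def)
  have wN: "root_of_unity N ^ N = 1"
    using assms by (simp add: root_of_unity_power exp_eq_1)
  have "?z = exp (2 * of_int d * complex_of_real pi * \<i> / of_nat N)"
    by (simp add: root_of_unity_def exp_power_int mult_ac)
  moreover have "2 * real_of_int d * pi / real N \<noteq> real_of_int (2 * k) * pi" for k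
  proof
    assume "2 * real_of_int d * pi / real N = real_of_int (2 * k) * pi"
    then have "real_of_int d = real_of_int (k * int N)"
      using assms by (simp add: field_simps)
    then have "d = k * int N" by linarith
    then show False using False assms by (auto simp: abs_mult)
  qed
  ultimately have z1: "?z \<noteq> 1" by (auto simp: exp_eq_1)
  have "?z ^ N = 1"
    by (metis wN mult.commute power_int_mult power_int_of_nat power_int_1_left)
  then show ?thesis using False geometric_sum[OF z1, of N] by simp
qed simp

lemma sum_characters:
  assumes "k < N" "l < N"
  shows "(\<Sum>i<N. cnj (root_of_unity N ^ (i * k)) * root_of_unity N ^ (i * l)) =
    (if k = l then of_nat N else 0)"
proof -
  have w0: "root_of_unity N \<noteq> 0" by (simp add: root_of_unity_def)
  have "cnj (root_of_unity N ^ (i * k)) * root_of_unity N ^ (i * l) =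
    (root_of_unity N powi (int l - int k)) ^ i" for i
    using w0 by (simp add: power_int_diff cnj_root_of_unity power_divide field_simps flip: power_mult)
  then show ?thesis
    using sum_root_of_unity[of N "int l - int k"] assms by auto
qed

text \<open>Fourier inversion: only the trivial coefficient contributes, and it gives the mean of
  \<open>v\<close>.\<close>

lemma orthogonal_to_characters_imp_constant:
  assumes orth: "\<And>k. 1 \<le> k \<Longrightarrow> k < N \<Longrightarrow> (\<Sum>i<N. cnj (root_of_unity N ^ (i * k)) * v i) = 0"
    and j: "j < N"
  shows "v j = (\<Sum>i<N. v i) / of_nat N"
proof -
  let ?w = "root_of_unity N"
  \<comment> \<open>The exponent \<open>i * k\<close> is symmetric, so \<open>sum_characters\<close>
    also applies when summing over characters instead of points.\<close>
  have "(\<Sum>k<N. ?w ^ (j * k) * (\<Sum>i<N. cnj (?w ^ (i * k)) * v i)) =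
    (\<Sum>i<N. v i * (\<Sum>k<N. cnj (?w ^ (k * i)) * ?w ^ (k * j)))"
    unfolding sum_distrib_left by (subst sum.swap) (simp only: mult_ac)
  also have "\<dots> = (\<Sum>i<N. if i = j then of_nat N * v j else 0)"
    using j by (intro sum.cong refl) (simp add: sum_characters del: complex_cnj_power)
  also have "\<dots> = of_nat N * v j" using j by simp
  finally have "of_nat N * v j = (\<Sum>k<N. ?w ^ (j * k) * (\<Sum>i<N. cnj (?w ^ (i * k)) * v i))" ..
  also have "\<dots> = (\<Sum>k<N. if k = 0 then \<Sum>i<N. v i else 0)"
    using orth by (intro sum.cong refl) auto
  also have "\<dots> = (\<Sum>i<N. v i)" using j by simp
  finally show ?thesis using j by (simp add: field_simps)
qed

section \<open>The Hermitian product\<close>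

lemma cinner_add_left: "cinner (u + v) w = cinner u w + cinner v w"
  by (simp add: cinner_def sum.distrib algebra_simps)

lemma cinner_add_right: "cinner w (u + v) = cinner w u + cinner w v"
  by (simp add: cinner_def sum.distrib algebra_simps)

lemma cinner_diff_left: "cinner (u - v) w = cinner u w - cinner v w"
  by (simp add: cinner_def sum_subtractf algebra_simps)

lemma cinner_diff_right: "cinner w (u - v) = cinner w u - cinner w v"
  by (simp add: cinner_def sum_subtractf algebra_simps)

lemma cinner_scale_left: "cinner (c *s u) w = cnj c * cinner u w"
  by (simp add: cinner_def sum_distrib_left algebra_simps)

lemma cinner_scale_right: "cinner w (c *s u) = c * cinner w u"
  by (simp add: cinner_def sum_distrib_left algebra_simps)

lemma cinner_zero_left: "cinner 0 w = 0"
  by (simp add: cinner_def)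

lemma cinner_zero_right: "cinner w 0 = 0"
  by (simp add: cinner_def)

lemma cinner_sum_left: "cinner (\<Sum>i\<in>I. u i) w = (\<Sum>i\<in>I. cinner (u i) w)"
  by (induction I rule: infinite_finite_induct) (auto simp: cinner_zero_left cinner_add_left)

lemma cinner_sum_right: "cinner w (\<Sum>i\<in>I. u i) = (\<Sum>i\<in>I. cinner w (u i))"
  by (induction I rule: infinite_finite_induct) (auto simp: cinner_zero_right cinner_add_right)

lemma cnj_cinner: "cnj (cinner u v) = cinner v u"
  by (simp add: cinner_def mult.commute)

lemma cinner_self_eq_0: "cinner u u = 0 \<longleftrightarrow> u = 0"
proof
  assume "cinner u u = 0"
  moreover have "cinner u u = complex_of_real (\<Sum>i\<in>UNIV. (cmod (u $ i))\<^sup>2)"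
    by (simp add: cinner_def complex_norm_square mult.commute flip: of_real_power)
  ultimately have "(\<Sum>i\<in>UNIV. (cmod (u $ i))\<^sup>2) = 0"
    by (metis of_real_eq_0_iff)
  then show "u = 0" by (simp add: sum_nonneg_eq_0_iff vec_eq_iff)
qed (simp add: cinner_zero_left)

lemma cinner_tensor: "cinner (u \<otimes> v) (u' \<otimes> v') = cinner u u' * cinner v v'"
proof -
  have "cinner (u \<otimes> v) (u' \<otimes> v') =
    (\<Sum>p\<in>UNIV \<times> UNIV. (cnj (u $ fst p) * u' $ fst p) * (cnj (v $ snd p) * v' $ snd p))"
    by (simp add: cinner_def tensor_def mult_ac)
  also have "\<dots> = cinner u u' * cinner v v'"
    by (simp add: cinner_def sum_product sum.cartesian_product case_prod_beta)
  finally show ?thesis .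
qed

lemma tensor_scale_left: "(c *s u) \<otimes> v = c *s (u \<otimes> v)"
  by (simp add: tensor_def vec_eq_iff mult_ac)

lemma sum_tensor_sum: "(\<Sum>i\<in>I. \<Sum>j\<in>J. u i \<otimes> v j) = (\<Sum>i\<in>I. u i) \<otimes> (\<Sum>j\<in>J. v j)"
  by (simp add: tensor_def vec_eq_iff sum_component sum_product)

lemma orthonormal_basis_cinner:
  assumes "orthonormal_basis d e" "i < d" "j < d"
  shows "cinner (e i) (e j) = (if i = j then 1 else 0)"
proof -
  have "e i \<noteq> e j" if "i \<noteq> j"
    using assms that by (auto simp: orthonormal_basis_def inj_on_def)
  then show ?thesis
    using assms unfolding orthonormal_basis_def orthonormal_def by auto
qed

text \<open>A vector whose coordinates all vanish is orthogonal to the span of the basis, hence to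
  itself.\<close>

lemma orthonormal_basis_coordinate_nonzero:
  assumes "orthonormal_basis d e" "u \<noteq> 0"
  shows "\<exists>i<d. cinner (e i) u \<noteq> 0"
proof (rule ccontr)
  assume "\<not> (\<exists>i<d. cinner (e i) u \<noteq> 0)"
  then have *: "cinner x u = 0" if "x \<in> e ` {..<d}" for x using that by auto
  have "cinner x u = 0" if "x \<in> vec.span (e ` {..<d})" for x
    using that by (induction rule: vec.span_induct_alt)
      (auto simp: * cinner_zero_left cinner_add_left cinner_scale_left)
  then show False using assms cinner_self_eq_0 by (auto simp: orthonormal_basis_def)
qed

section \<open>The tiles\<close>

text \<open>Merges the two ranges of \<open>ltile\<close> into one index \<open>i < n - 2\<close>.
  For \<open>j < m\<close> the first branch runs cyclically through the columns below
  \<open>m\<close> other than \<open>j - 1\<close> and \<open>j\<close> (modulo \<open>m\<close>);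
  the second lists the columns from \<open>m\<close> on.\<close>

definition long_column :: "nat \<Rightarrow> nat \<Rightarrow> nat \<Rightarrow> nat" where
  "long_column m j i = (if i < m - 2 then (i + j + 1) mod m else i + 2)"

text \<open>An injection of \<open>n - 2\<close> indices into a set of \<open>n - 2\<close> columns
  is onto. Naming the row as a successor avoids a cyclic predecessor in the omitted pair.\<close>

lemma bij_long_column:
  assumes "m \<ge> 3" "n \<ge> m" "j < m"
  shows "bij_betw (long_column m ((j + 1) mod m)) {..<n - 2} ({..<n} - {j, (j + 1) mod m})"
proof -
  define j' where "j' = (j + 1) mod m"
  have j': "j' = (if j = m - 1 then 0 else j + 1)" using assms by (auto simp: j'_def)
  have j'_less: "j' < m" using assms by (simp add: j'_def)
  \<comment> \<open>The dividend is below \<open>2 * m\<close>, so \<open>mod\<close> is one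
    conditional subtraction and linear arithmetic applies.\<close>
  have val: "long_column m j' i =
    (if i < m - 2 then if i + j' + 1 < m then i + j' + 1 else i + j' + 1 - m else i + 2)" for i
    using j'_less by (auto simp: long_column_def le_mod_geq)
  have inj: "inj_on (long_column m j') {..<n - 2}"
  proof (rule inj_onI)
    fix x y
    assume "long_column m j' x = long_column m j' y"
    then show "x = y" unfolding val using j'_less by (simp split: if_splits)
  qed
  moreover have sub: "long_column m j' ` {..<n - 2} \<subseteq> {..<n} - {j, j'}"
  proof (rule image_subsetI)
    fix x
    assume "x \<in> {..<n - 2}"
    then show "long_column m j' x \<in> {..<n} - {j, j'}"
      unfolding val using assms j' j'_less by (simp split: if_splits; linarith)
  qed
  moreover have "card ({..<n} - {j, j'}) = n - 2"
    using assms j' by (subst card_Diff_subset) auto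
  ultimately have "long_column m j' ` {..<n - 2} = {..<n} - {j, j'}"
    by (intro card_subset_eq) (auto simp: card_image)
  with inj show ?thesis by (simp add: bij_betw_def j'_def)
qed

definition long_vector :: "nat \<Rightarrow> nat \<Rightarrow> (nat \<Rightarrow> complex ^ 'b::finite) \<Rightarrow> nat \<Rightarrow> nat \<Rightarrow> complex ^ 'b"
  where "long_vector m n f j k = complex_of_real (1 / sqrt (real (n - 2))) *s
    (\<Sum>i<n - 2. root_of_unity (n - 2) ^ (i * k) *s f (long_column m j i))"

lemma ltile_eq:
  assumes "m \<ge> 3" "n \<ge> m"
  shows "ltile m n e f j k = e j \<otimes> long_vector m n f j k"
proof -
  have "{..<n - 2} = {0..m - 3} \<union> {m - 2..n - 3}" "{0..m - 3} \<inter> {m - 2..n - 3} = {}"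
    using assms by auto
  then have "(\<Sum>i<n - 2. root_of_unity (n - 2) ^ (i * k) *s f (long_column m j i)) =
    (\<Sum>i = 0..m - 3. root_of_unity (n - 2) ^ (i * k) *s f (long_column m j i)) +
    (\<Sum>i = m - 2..n - 3. root_of_unity (n - 2) ^ (i * k) *s f (long_column m j i))"
    by (simp add: sum.union_disjoint)
  also have "\<dots> = (\<Sum>i = 0..m - 3. root_of_unity (n - 2) ^ (i * k) *s f ((i + j + 1) mod m)) +
    (\<Sum>i = m - 2..n - 3. root_of_unity (n - 2) ^ (i * k) *s f (i + 2))"
    using assms by (intro arg_cong2[of _ _ _ _ "(+)"] sum.cong) (auto simp: long_column_def)
  finally show ?thesis
    by (simp add: ltile_def long_vector_def root_of_unity_def Let_def)
qed

text \<open>The constant function on the grid factorises; this makes \<open>ftile\<close> a product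
  vector and splits its inner products into two sums.\<close>

lemma ftile_eq:
  assumes "m > 0" "n > 0"
  shows "ftile m n e f =
    complex_of_real (1 / sqrt (real (n * m))) *s ((\<Sum>i<m. e i) \<otimes> (\<Sum>j<n. f j))"
proof -
  have "{0..m - 1} = {..<m}" "{0..n - 1} = {..<n}" using assms by auto
  then show ?thesis by (simp add: ftile_def sum_tensor_sum)
qed

locale tiles =
  fixes m n :: nat
    and e :: "nat \<Rightarrow> complex ^ 'a::finite"
    and f :: "nat \<Rightarrow> complex ^ 'b::finite"
  assumes n: "n > 3" and m: "m \<ge> 3" and nm: "n \<ge> m"
    and e: "orthonormal_basis m e" and f: "orthonormal_basis n f"
begin

lemma cinner_e: "i < m \<Longrightarrow> j < m \<Longrightarrow> cinner (e i) (e j) = (if i = j then 1 else 0)"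
  using orthonormal_basis_cinner[OF e] .

lemma cinner_f: "i < n \<Longrightarrow> j < n \<Longrightarrow> cinner (f i) (f j) = (if i = j then 1 else 0)"
  using orthonormal_basis_cinner[OF f] .

lemma cyclic_pred:
  assumes "j < m"
  obtains l where "l < m" "j = (l + 1) mod m"
proof
  show "(if j = 0 then m - 1 else j - 1) < m" using assms m by auto
  show "j = ((if j = 0 then m - 1 else j - 1) + 1) mod m" using assms m by auto
qed

lemma bij_long_column_pred:
  assumes "j < m"
  obtains l where "l < m" "j = (l + 1) mod m"
    "bij_betw (long_column m j) {..<n - 2} ({..<n} - {l, j})"
  using cyclic_pred[OF assms] bij_long_column[OF m nm] by metis

lemma long_column_less: "j < m \<Longrightarrow> i < n - 2 \<Longrightarrow> long_column m j i < n"
  by (rule bij_long_column_pred[of j]) (auto dest: bij_betwE)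

lemma long_column_eq_iff:
  "j < m \<Longrightarrow> i < n - 2 \<Longrightarrow> i' < n - 2 \<Longrightarrow> long_column m j i = long_column m j i' \<longleftrightarrow> i = i'"
  by (rule bij_long_column_pred[of j]) (auto simp: bij_betw_def inj_on_def)

section \<open>Inner products of the long vectors\<close>

lemma cinner_long_vector:
  "cinner (long_vector m n f j k) b = complex_of_real (1 / sqrt (real (n - 2))) *
    (\<Sum>i<n - 2. cnj (root_of_unity (n - 2) ^ (i * k)) * cinner (f (long_column m j i)) b)"
  by (simp add: long_vector_def cinner_scale_left cinner_sum_left)

lemma cinner_f_long_vector:
  assumes "j < m" "i < n - 2"
  shows "cinner (f (long_column m j i)) (long_vector m n f j k) =
    complex_of_real (1 / sqrt (real (n - 2))) * root_of_unity (n - 2) ^ (i * k)"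
proof -
  have "(\<Sum>i'<n - 2. root_of_unity (n - 2) ^ (i' * k) *
      cinner (f (long_column m j i)) (f (long_column m j i'))) =
    (\<Sum>i'<n - 2. if i' = i then root_of_unity (n - 2) ^ (i * k) else 0)"
    using assms by (intro sum.cong) (auto simp: cinner_f long_column_less long_column_eq_iff)
  then show ?thesis using assms
    by (simp add: long_vector_def cinner_scale_right cinner_sum_right)
qed

lemma cinner_long_long:
  assumes "j < m" "k < n - 2" "k' < n - 2"
  shows "cinner (long_vector m n f j k) (long_vector m n f j k') = (if k = k' then 1 else 0)"
proof -
  let ?c = "complex_of_real (1 / sqrt (real (n - 2)))"
  have "cinner (long_vector m n f j k) (long_vector m n f j k') =
    ?c * (\<Sum>i<n - 2. ?c * (cnj (root_of_unity (n - 2) ^ (i * k)) * root_of_unity (n - 2) ^ (i * k')))"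
    using assms by (simp add: cinner_long_vector cinner_f_long_vector mult_ac)
  also have "\<dots> = (?c * ?c) * (if k = k' then of_nat (n - 2) else 0)"
    using assms by (simp only: sum_distrib_left[symmetric] sum_characters mult.assoc)
  also have "?c * ?c = complex_of_real (1 / real (n - 2))"
    by (simp flip: of_real_mult)
  also have "complex_of_real (1 / real (n - 2)) * (if k = k' then of_nat (n - 2) else 0) =
    (if k = k' then 1 else 0)" using n by (simp del: of_nat_diff)
  finally show ?thesis .
qed

lemma cinner_sum_f_long:
  assumes "j < m" "1 \<le> k" "k < n - 2"
  shows "cinner (long_vector m n f j k) (\<Sum>c<n. f c) = 0"
proof -
  have "cinner (f (long_column m j i)) (\<Sum>c<n. f c) = 1" if "i < n - 2" for i
  proof -
    have "cinner (f (long_column m j i)) (\<Sum>c<n. f c) =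
      (\<Sum>c<n. if c = long_column m j i then 1 else 0)"
      unfolding cinner_sum_right
      using assms that by (intro sum.cong) (auto simp: cinner_f long_column_less)
    then show ?thesis using long_column_less assms that by simp
  qed
  \<comment> \<open>All coordinates being 1, the basis sum acts as the trivial character
    \<open>0\<close>, which differs from \<open>k\<close> since \<open>1 \<le> k\<close>.\<close>
  then show ?thesis using sum_characters[of k "n - 2" 0] assms
    by (simp add: cinner_long_vector)
qed

text \<open>Column \<open>j\<close> is omitted from both rows occupied by the short tile
  \<open>j\<close>; this separates a short tile from the long tiles sharing a row with it.\<close>

lemma cinner_long_f:
  assumes "j < m"
  shows "cinner (long_vector m n f j k) (f j) = 0"
    and "cinner (long_vector m n f ((j + 1) mod m) k) (f j) = 0"
proof -
  have *: "cinner (long_vector m n f j k) (f c) = 0"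
    if "j < m" "c < n" "\<And>i. i < n - 2 \<Longrightarrow> long_column m j i \<noteq> c" for j c
    using that by (auto simp: cinner_long_vector cinner_f long_column_less intro!: sum.neutral)
  show "cinner (long_vector m n f j k) (f j) = 0"
    using assms nm by (intro *) (auto intro: bij_long_column_pred[OF assms] dest: bij_betwE)
  show "cinner (long_vector m n f ((j + 1) mod m) k) (f j) = 0"
    using assms nm m bij_betwE[OF bij_long_column[OF m nm assms]] by (intro *) auto
qed

section \<open>Inner products between tiles\<close>

lemma cinner_stile:
  "cinner (stile m e f j) (a \<otimes> b) = complex_of_real (1 / sqrt 2) *
    (cinner (e j) a - cinner (e ((j + 1) mod m)) a) * cinner (f j) b"
  by (simp add: stile_def cinner_tensor cinner_scale_left cinner_diff_left algebra_simps)

lemma cinner_ltile: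
  "cinner (ltile m n e f j k) (a \<otimes> b) = cinner (e j) a * cinner (long_vector m n f j k) b"
  by (simp add: ltile_eq m nm cinner_tensor)

lemma cinner_ftile:
  "cinner (ftile m n e f) (a \<otimes> b) = complex_of_real (1 / sqrt (real (n * m))) *
    ((\<Sum>i<m. cinner (e i) a) * (\<Sum>j<n. cinner (f j) b))"
  using m n by (simp add: ftile_eq cinner_tensor cinner_scale_left cinner_sum_left)

lemma cyclic_succ_neq: "j < m \<Longrightarrow> (j + 1) mod m \<noteq> j"
  using m by (auto simp: mod_if)

lemma cyclic_succ_less: "(j + 1) mod m < m"
  using m by simp

lemma stile_stile:
  assumes "j < m" "j' < m"
  shows "cinner (stile m e f j) (stile m e f j') = (if j = j' then 1 else 0)"
proof (cases "j = j'")
  case True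
  have "complex_of_real (1 / sqrt 2) * complex_of_real (1 / sqrt 2) = 1 / 2"
    by (simp flip: of_real_mult)
  then show ?thesis using True assms nm cyclic_succ_neq[of j] cyclic_succ_less[of j]
    \<comment> \<open>Only the second argument is unfolded, so that \<open>cinner_stile\<close>
      matches the first.\<close>
    by (subst (2) stile_def)
      (simp add: cinner_stile cinner_scale_right cinner_diff_right cinner_e cinner_f)
next
  case False
  then show ?thesis using assms nm
    by (subst (2) stile_def) (simp add: cinner_stile cinner_f)
qed

lemma ltile_ltile:
  assumes "j < m" "j' < m" "k < n - 2" "k' < n - 2"
  shows "cinner (ltile m n e f j k) (ltile m n e f j' k') = (if j = j' \<and> k = k' then 1 else 0)"
  using assms
  by (subst (2) ltile_eq[OF m nm]) (simp add: cinner_ltile cinner_e cinner_long_long)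

lemma ftile_ftile: "cinner (ftile m n e f) (ftile m n e f) = 1"
proof -
  let ?c = "complex_of_real (1 / sqrt (real (n * m)))"
  have se: "cinner (e i) (\<Sum>i<m. e i) = 1" if "i < m" for i
    unfolding cinner_sum_right using that by (simp add: cinner_e)
  have sf: "cinner (f i) (\<Sum>i<n. f i) = 1" if "i < n" for i
    unfolding cinner_sum_right using that by (simp add: cinner_f)
  have "cinner (ftile m n e f) (ftile m n e f) = (?c * ?c) * of_nat (n * m)"
    using m n by (subst (2) ftile_eq)
      (auto simp: cinner_scale_right cinner_ftile se sf mult_ac)
  also have "?c * ?c = complex_of_real (1 / real (n * m))"
    by (simp flip: of_real_mult)
  finally show ?thesis using m n by simp
qed

text \<open>If the long tile lies in a row of the short one, its second factor misses column
  \<open>j'\<close>; otherwise the first factors are orthogonal.\<close>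

lemma ltile_stile:
  assumes "j < m" "j' < m"
  shows "cinner (ltile m n e f j k) (stile m e f j') = 0"
proof (cases "j = j' \<or> j = (j' + 1) mod m")
  case True
  then have "cinner (long_vector m n f j k) (f j') = 0" using assms cinner_long_f by blast
  then show ?thesis by (simp add: stile_def cinner_ltile)
next
  case False
  then show ?thesis using assms cyclic_succ_less[of j']
    by (simp add: stile_def cinner_ltile cinner_scale_right cinner_diff_right cinner_e)
qed

text \<open>Each \<open>e l\<close> has coordinate sum 1, so the difference in the short tile has
  coordinate sum 0.\<close>

lemma ftile_stile:
  assumes "j < m"
  shows "cinner (ftile m n e f) (stile m e f j) = 0"
proof -
  have "(\<Sum>i<m. cinner (e i) (e l)) = 1" if "l < m" for l
    using that by (simp add: cinner_e)
  then show ?thesis using assms cyclic_succ_less[of j]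
    by (simp add: stile_def cinner_ftile cinner_scale_right cinner_diff_right
      sum_subtractf flip: sum_distrib_left sum_divide_distrib)
qed

lemma ltile_ftile:
  assumes "j < m" "1 \<le> k" "k < n - 2"
  shows "cinner (ltile m n e f j k) (ftile m n e f) = 0"
  using m n assms
  by (subst ftile_eq) (auto simp: cinner_scale_right cinner_ltile cinner_sum_f_long)

section \<open>The defining properties of an unextendible product basis\<close>

lemma GenTiles2_cases:
  assumes "x \<in> GenTiles2 m n e f"
  obtains (S) j where "j < m" "x = stile m e f j"
  | (L) j k where "j < m" "1 \<le> k" "k < n - 2" "x = ltile m n e f j k"
  | (F) "x = ftile m n e f"
proof -
  have "j \<le> m - 1 \<longleftrightarrow> j < m" "k \<le> n - 3 \<longleftrightarrow> k < n - 2" for j k using m n by auto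
  then show ?thesis using assms that by (auto simp: GenTiles2_def)
qed

lemma orthonormal_GenTiles2: "orthonormal (GenTiles2 m n e f)"
  unfolding orthonormal_def
proof (intro conjI ballI impI)
  fix x assume "x \<in> GenTiles2 m n e f"
  then show "cinner x x = 1"
    by (cases rule: GenTiles2_cases) (auto simp: stile_stile ltile_ltile ftile_ftile)
next
  \<comment> \<open>Mixed inner products were computed in one order only; conjugate symmetry gives
    the other.\<close>
  have sym: "cinner u v = 0 \<Longrightarrow> cinner v u = 0" for u v :: "complex ^ ('a \<times> 'b)"
    using cnj_cinner[of u v] by simp
  fix x y assume x: "x \<in> GenTiles2 m n e f" and y: "y \<in> GenTiles2 m n e f" and "x \<noteq> y"
  show "cinner x y = 0"
    by (rule GenTiles2_cases[OF x]; rule GenTiles2_cases[OF y]; use \<open>x \<noteq> y\<close> in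
      \<open>auto simp: stile_stile ltile_ltile ltile_stile ftile_stile ltile_ftile
        sym[OF ltile_stile] sym[OF ftile_stile] sym[OF ltile_ftile]\<close>)
qed

lemma product_state_GenTiles2:
  assumes "x \<in> GenTiles2 m n e f"
  shows "product_state x"
proof -
  have "x \<noteq> 0"
    using orthonormal_GenTiles2 assms cinner_zero_left[of x] unfolding orthonormal_def
    by (metis zero_neq_one)
  moreover have "\<exists>a b. x = a \<otimes> b" using assms
  proof (cases rule: GenTiles2_cases)
    case F
    moreover have "0 < m" "0 < n" using m n by auto
    ultimately show ?thesis by (metis ftile_eq tensor_scale_left)
  qed (auto simp: stile_def ltile_eq[OF m nm])
  ultimately show ?thesis by (simp add: product_state_def)
qed

text \<open>Dimension count: there are at most
  \<open>m + m * (n - 3) + 1 = m * n - 2 * m + 1\<close> tiles, fewer than the dimension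
  \<open>m * n\<close>.\<close>

lemma span_GenTiles2:
  assumes "CARD('a) = m" "CARD('b) = n"
  shows "vec.span (GenTiles2 m n e f) \<subset> UNIV"
proof -
  let ?T = "stile m e f ` {..<m} \<union> (\<lambda>(j, k). ltile m n e f j k) ` ({..<m} \<times> {1..<n - 2}) \<union>
    {ftile m n e f}"
  have sub: "GenTiles2 m n e f \<subseteq> ?T"
    by (auto elim!: GenTiles2_cases)
  have "card ?T \<le> card (stile m e f ` {..<m}) +
    card ((\<lambda>(j, k). ltile m n e f j k) ` ({..<m} \<times> {1..<n - 2})) + 1"
    by (intro order.trans[OF card_Un_le] add_mono order.refl card_Un_le) auto
  also have "\<dots> \<le> m + m * (n - 3) + 1"
    by (intro add_mono order.trans[OF card_image_le]) auto
  also have "\<dots> < m * n"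
  proof -
    obtain n' where "n = n' + 3" using n less_imp_add_positive[of 3 n] by (auto simp: add.commute)
    then show ?thesis using m by (simp add: algebra_simps)
  qed
  finally have "card ?T < m * n" .
  moreover have "vec.dim (GenTiles2 m n e f) \<le> card ?T"
    by (rule vec.dim_le_card[OF subset_trans[OF sub vec.span_superset]]) simp
  moreover have "vec.dim (UNIV :: (complex ^ ('a \<times> 'b)) set) = m * n"
    using assms by (simp add: card_cart_basis)
  ultimately show ?thesis by (metis vec.dim_span leD psubsetI top_greatest)
qed

text \<open>In coordinates, orthogonality to the short tiles is the \<open>col\<close> hypothesis of
  \<open>tile_constant_sums_nonzero\<close>, orthogonality to the long tiles gives
  \<open>row\<close>, and orthogonality to \<open>ftile\<close> contradicts its conclusion.\<close>

lemma orthogonal_tensor_eq_0: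
  assumes orth: "\<And>x. x \<in> GenTiles2 m n e f \<Longrightarrow> cinner x (a \<otimes> b) = 0"
    and a: "a \<noteq> 0" and b: "b \<noteq> 0"
  shows False
proof -
  define \<alpha> where "\<alpha> i = cinner (e i) a" for i
  define \<beta> where "\<beta> i = cinner (f i) b" for i
  have "sum \<alpha> {..<m} * sum \<beta> {..<n} \<noteq> 0"
  proof (rule tile_constant_sums_nonzero[OF m nm n])
    fix j assume "j < m"
    then have "stile m e f j \<in> GenTiles2 m n e f" by (auto simp: GenTiles2_def)
    from orth[OF this] show "\<beta> j = 0 \<or> \<alpha> j = \<alpha> ((j + 1) mod m)"
      by (auto simp: cinner_stile \<alpha>_def \<beta>_def)
  next
    fix j c c'
    define j' where "j' = (j + 1) mod m"
    assume j: "j < m" and nz: "\<alpha> ((j + 1) mod m) \<noteq> 0"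
      and c: "c \<in> {..<n} - {j, (j + 1) mod m}" "c' \<in> {..<n} - {j, (j + 1) mod m}"
    \<comment> \<open>The factor \<open>\<alpha> j'\<close> of the inner product with the long tile
      is nonzero and cancels, leaving a condition on \<open>\<beta>\<close> alone.\<close>
    have *: "(\<Sum>i<n - 2. cnj (root_of_unity (n - 2) ^ (i * k)) * \<beta> (long_column m j' i)) = 0"
      if "1 \<le> k" "k < n - 2" for k
    proof -
      have "j' \<le> m - 1" "k \<le> n - 3"
        using cyclic_succ_less[of j] that by (auto simp: j'_def)
      then have "ltile m n e f j' k \<in> GenTiles2 m n e f"
        using that unfolding GenTiles2_def by blast
      from orth[OF this] show ?thesis
        using nz n by (simp add: cinner_ltile cinner_long_vector \<alpha>_def \<beta>_def j'_def)
    qed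
    have bij: "bij_betw (long_column m j') {..<n - 2} ({..<n} - {j, j'})"
      using bij_long_column[OF m nm j] by (simp add: j'_def)
    obtain i i' where "i < n - 2" "i' < n - 2" "c = long_column m j' i" "c' = long_column m j' i'"
      using c bij_betw_imp_surj_on[OF bij] unfolding j'_def by (metis imageE lessThan_iff)
    \<comment> \<open>Both values equal the same mean over row \<open>j'\<close>.\<close>
    then show "\<beta> c = \<beta> c'"
      using orthogonal_to_characters_imp_constant[of "n - 2" "\<lambda>i. \<beta> (long_column m j' i)", OF *]
      by metis
  next
    show "\<exists>i<m. \<alpha> i \<noteq> 0" "\<exists>j<n. \<beta> j \<noteq> 0"
      using orthonormal_basis_coordinate_nonzero e f a b unfolding \<alpha>_def \<beta>_def by blast+
  qed
  moreover have "ftile m n e f \<in> GenTiles2 m n e f" by (simp add: GenTiles2_def)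
  from orth[OF this] have "sum \<alpha> {..<m} * sum \<beta> {..<n} = 0"
    using m n by (auto simp: cinner_ftile \<alpha>_def \<beta>_def)
  ultimately show False by simp
qed

end

theorem theorem2:
  fixes m n :: nat
    and e :: "nat \<Rightarrow> complex ^ 'a::finite"
    and f :: "nat \<Rightarrow> complex ^ 'b::finite"
  assumes "n > 3" and "m \<ge> 3" and "n \<ge> m"
    and "CARD('a) = m" and "CARD('b) = n"
    and "orthonormal_basis m e" and "orthonormal_basis n f"
  shows "unextendible_product_basis (GenTiles2 m n e f)"
proof -
  interpret tiles m n e f using assms by unfold_locales
  have "\<not> product_state x" if "x \<in> orthogonal_complement (vec.span (GenTiles2 m n e f))" for x
  proof
    assume "product_state x"
    then obtain a b where x: "x = a \<otimes> b" "a \<otimes> b \<noteq> 0" by (auto simp: product_state_def)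
    then have "a \<noteq> 0" "b \<noteq> 0" by (auto simp: tensor_def vec_eq_iff)
    then show False
      using orthogonal_tensor_eq_0[of a b] that x
      by (auto simp: orthogonal_complement_def vec.span_base)
  qed
  then show ?thesis
    using product_state_GenTiles2 orthonormal_GenTiles2 span_GenTiles2 assms
    by (auto simp: unextendible_product_basis_def partial_product_basis_def)
qed

end
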